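(* Let $R$ and $S$ be finite commutative rings. If $R\cong S$ as rings, then $\zeta_k(R)=\zeta_k(S)$ for every integer $k\ge 2$.
   Context: For a finite commutative ring $R$, let $\mathcal I(R)$ denote the set of all ideals of $R$. For an integer $k\ge 2$, the ideal zero-product probability is $$\zeta_k(R)=\frac{|\{(I_1,\ldots,I_k)\in\mathcal I(R)^k : I_1I_2\cdots I_k=(0)\}|}{|\mathcal I(R)|^k},$$ where $I_1\cdots I_k$ is the usual product of ideals. *)

theory Defs
  imports "HOL-Algebra.QuotRing" "HOL-Algebra.Ideal_Product" "HOL.Real"
begin

definition all_ideals :: "('a, 'm) ring_scheme \<Rightarrow> 'a set set"
  where "all_ideals R = {I. ideal I R}"

text \<open>
  A \<open>k\<close>-tuple of ideals is an extensional function on \<open>{..<k}\<close>, so that each tuple is counted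
  exactly once. The library record \<^const>\<open>ideals_set\<close> has the usual ideal product as its
  multiplication; it is a commutative monoid when \<open>R\<close> is a commutative ring, so the iterated
  product is then the usual \<open>I\<^sub>1 \<cdots> I\<^sub>k\<close>.
\<close>

definition zero_product_tuples :: "('a, 'm) ring_scheme \<Rightarrow> nat \<Rightarrow> (nat \<Rightarrow> 'a set) set"
  where "zero_product_tuples R k =
    {I \<in> {..<k} \<rightarrow>\<^sub>E all_ideals R. (\<Otimes>\<^bsub>ideals_set R\<^esub> i \<in> {..<k}. I i) = {\<zero>\<^bsub>R\<^esub>}}"

definition ideal_zero_prob :: "nat \<Rightarrow> ('a, 'm) ring_scheme \<Rightarrow> real"
  where "ideal_zero_prob k R =
    real (card (zero_product_tuples R k)) / real (card (all_ideals R)) ^ k"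

end

theory Submission
  imports Defs
begin

text \<open>The probability depends only on the commutative monoid of ideals under the ideal
  product, together with its element (0). A ring isomorphism \<open>h\<close> induces the map I |->
  h(I) on ideals, and this is an isomorphism of these monoids that sends (0) to (0)
  (\<open>image_iso_ideals_set\<close>). Applying a monoid isomorphism to each coordinate is a
  bijection on k-tuples that commutes with taking the product, so it matches the tuples with product
  z with those whose product is the image of z (\<open>card_finprod_eq_iso\<close>). Numerator and
  denominator therefore agree separately.\<close>

text \<open>\<open>hom\<close> records multiplicativity only, so preservation of the unit is a
  separate hypothesis; it settles the empty product, where the induction starts.\<close>

lemma hom_finprod:
  assumes "comm_monoid G" and "comm_monoid H" and h: "h \<in> hom G H" and one: "h \<one>\<^bsub>G\<^esub> = \<one>\<^bsub>H\<^esub>"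
    and "finite A" and "f \<in> A \<rightarrow> carrier G"
  shows "h (finprod G f A) = finprod H (\<lambda>i. h (f i)) A"
proof -
  interpret G: comm_monoid G by fact
  interpret H: comm_monoid H by fact
  show ?thesis
    using \<open>finite A\<close> \<open>f \<in> A \<rightarrow> carrier G\<close>
  proof (induction A rule: finite_induct)
    case empty
    then show ?case by (simp add: one)
  next
    case (insert a A)
    then have "f \<in> A \<rightarrow> carrier G" "f a \<in> carrier G" by auto
    moreover from this have "(\<lambda>i. h (f i)) \<in> A \<rightarrow> carrier H" "h (f a) \<in> carrier H"
      using h by (auto simp: hom_def)
    ultimately show ?case
      using insert by (simp add: hom_mult[OF h])
  qed
qed

text \<open>Composition with \<open>h\<close> is a bijection of tuples, inverted by composition with
  the inverse of \<open>h\<close>. It carries the fibre of the product map over \<open>z\<close> to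
  the fibre over \<open>h z\<close>.\<close>

lemma card_finprod_eq_iso:
  assumes G: "comm_monoid G" and H: "comm_monoid H" and h: "h \<in> iso G H" and one: "h \<one>\<^bsub>G\<^esub> = \<one>\<^bsub>H\<^esub>"
    and "finite A" and z: "z \<in> carrier G"
  shows "card {f \<in> A \<rightarrow>\<^sub>E carrier G. finprod G f A = z} =
    card {f \<in> A \<rightarrow>\<^sub>E carrier H. finprod H f A = h z}" (is "card ?X = card ?Y")
proof -
  interpret G: comm_monoid G by fact
  interpret H: comm_monoid H by fact
  let ?g = "inv_into (carrier G) h"
  have hom: "h \<in> hom G H" and bij: "bij_betw h (carrier G) (carrier H)"
    using h by (auto simp: iso_def)
  have hg: "h (?g y) = y" "?g y \<in> carrier G" if "y \<in> carrier H" for y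
    using bij that by (auto simp: bij_betw_inv_into_right bij_betw_def inv_into_into)
  have gh: "?g (h x) = x" "h x \<in> carrier H" if "x \<in> carrier G" for x
    using bij that by (auto simp: bij_betw_inv_into_left bij_betw_def)
  have fin: "finprod H (\<lambda>i\<in>A. h (f i)) A = h (finprod G f A)" if "f \<in> A \<rightarrow>\<^sub>E carrier G" for f
  proof -
    \<comment> \<open>The restriction to \<open>A\<close> keeps the composed tuple extensional; the
      product sees only values on \<open>A\<close>.\<close>
    have "finprod H (\<lambda>i\<in>A. h (f i)) A = finprod H (\<lambda>i. h (f i)) A"
      using that gh by (intro H.finprod_cong') auto
    also have "\<dots> = h (finprod G f A)"
      using hom_finprod[OF G H hom one \<open>finite A\<close>, of f] that by (simp add: PiE_def)
    finally show ?thesis .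
  qed
  have "bij_betw (\<lambda>f. \<lambda>i\<in>A. h (f i)) ?X ?Y"
  proof (rule bij_betw_byWitness[where f' = "\<lambda>f. \<lambda>i\<in>A. ?g (f i)"])
    show "\<forall>f\<in>?X. (\<lambda>i\<in>A. ?g ((\<lambda>i\<in>A. h (f i)) i)) = f"
      using gh by (fastforce simp: fun_eq_iff PiE_iff extensional_def)
    have right: "(\<lambda>i\<in>A. h ((\<lambda>i\<in>A. ?g (f i)) i)) = f" if "f \<in> A \<rightarrow>\<^sub>E carrier H" for f
      using hg that by (fastforce simp: fun_eq_iff PiE_iff extensional_def)
    then show "\<forall>f\<in>?Y. (\<lambda>i\<in>A. h ((\<lambda>i\<in>A. ?g (f i)) i)) = f" by blast
    show "(\<lambda>f. \<lambda>i\<in>A. h (f i)) ` ?X \<subseteq> ?Y"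
      using fin gh(2) by (auto simp: PiE_iff)
    show "(\<lambda>f. \<lambda>i\<in>A. ?g (f i)) ` ?Y \<subseteq> ?X"
    proof (rule image_subsetI)
      fix f assume f: "f \<in> ?Y"
      let ?f = "\<lambda>i\<in>A. ?g (f i)"
      have mem: "?f \<in> A \<rightarrow>\<^sub>E carrier G"
        using f hg(2) by (auto simp: PiE_iff)
      have "h (finprod G ?f A) = h z"
        using fin[OF mem] right[of f] f by simp
      moreover have "finprod G ?f A \<in> carrier G"
        using mem by (intro G.finprod_closed) auto
      \<comment> \<open>Injectivity of \<open>h\<close> on the carrier cancels it from both
        sides.\<close>
      ultimately have "finprod G ?f A = z"
        using z gh(1) by metis
      with mem show "?f \<in> ?X" by simp
    qed
  qed
  then show ?thesis by (rule bij_betw_same_card)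
qed

text \<open>Surjectivity serves absorption: an arbitrary multiplier from \<open>S\<close> must be
  lifted to \<open>R\<close> before the ideal property of \<open>I\<close> applies.\<close>

lemma (in ring_hom_ring) image_ideal:
  assumes surj: "h ` carrier R = carrier S" and "ideal I R"
  shows "ideal (h ` I) S"
proof -
  interpret I: ideal I R by fact
  show ?thesis
  proof (rule idealI)
    show "ring S" by (rule S.ring_axioms)
    show "subgroup (h ` I) (add_monoid S)"
    proof -
      have "group_hom (add_monoid R) (add_monoid S) h"
        by (rule a_group_hom)
      then show ?thesis
        using group_hom.subgroup_img_is_subgroup I.a_subgroup by blast
    qed
  next
    fix a x assume "a \<in> h ` I" "x \<in> carrier S"
    then obtain b y where b: "b \<in> I" "a = h b" and y: "y \<in> carrier R" "x = h y"
      using surj by blast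
    then show "x \<otimes>\<^bsub>S\<^esub> a \<in> h ` I" "a \<otimes>\<^bsub>S\<^esub> x \<in> h ` I"
      using I.I_l_closed[OF b(1) y(1)] I.I_r_closed[OF b(1) y(1)] I.Icarr
      by (metis hom_mult imageI)+
  qed
qed

text \<open>Both sides are built inductively from products of elements by sums, and \<open>h\<close>
  respects both operations, so each inclusion is an induction over
  \<open>ideal_prod\<close>.\<close>

lemma (in ring_hom_ring) image_ideal_prod:
  assumes I: "ideal I R" and J: "ideal J R"
  shows "h ` (I \<cdot>\<^bsub>R\<^esub> J) = (h ` I) \<cdot>\<^bsub>S\<^esub> (h ` J)"
proof (intro subset_antisym subsetI)
  note carr = ideal.Icarr[OF I] ideal.Icarr[OF J] subsetD[OF R.ideal_prod_in_carrier[OF I J]]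
  {
    fix y assume "y \<in> h ` (I \<cdot>\<^bsub>R\<^esub> J)"
    then obtain x where "x \<in> I \<cdot>\<^bsub>R\<^esub> J" "y = h x" by blast
    from this(1) have "h x \<in> (h ` I) \<cdot>\<^bsub>S\<^esub> (h ` J)"
      by induction (auto simp: carr intro: ideal_prod.intros)
    with \<open>y = h x\<close> show "y \<in> (h ` I) \<cdot>\<^bsub>S\<^esub> (h ` J)" by simp
  next
    fix y assume "y \<in> (h ` I) \<cdot>\<^bsub>S\<^esub> (h ` J)"
    then show "y \<in> h ` (I \<cdot>\<^bsub>R\<^esub> J)"
    proof induction
      case (prod i j)
      then obtain a b where "a \<in> I" "b \<in> J" "i = h a" "j = h b" by blast
      then have "i \<otimes>\<^bsub>S\<^esub> j = h (a \<otimes>\<^bsub>R\<^esub> b)" "a \<otimes>\<^bsub>R\<^esub> b \<in> I \<cdot>\<^bsub>R\<^esub> J"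
        by (auto simp: carr intro: ideal_prod.prod)
      then show ?case by blast
    next
      case (sum s t)
      then obtain a b where "a \<in> I \<cdot>\<^bsub>R\<^esub> J" "b \<in> I \<cdot>\<^bsub>R\<^esub> J" "s = h a" "t = h b" by blast
      then have "s \<oplus>\<^bsub>S\<^esub> t = h (a \<oplus>\<^bsub>R\<^esub> b)" "a \<oplus>\<^bsub>R\<^esub> b \<in> I \<cdot>\<^bsub>R\<^esub> J"
        by (auto simp: carr intro: ideal_prod.sum)
      then show ?case by blast
    qed
  }
qed

text \<open>Taking images under \<open>h\<close> and under its inverse ring isomorphism gives
  mutually inverse maps between the sets of ideals; multiplicativity is
  \<open>image_ideal_prod\<close>.\<close>

lemma image_iso_ideals_set:
  assumes R: "ring R" and S: "ring S" and h: "h \<in> ring_iso R S"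
  shows "(`) h \<in> iso (ideals_set R) (ideals_set S)"
proof -
  let ?g = "inv_into (carrier R) h"
  have g: "?g \<in> ring_iso S R" by (rule ring_iso_set_sym[OF R h])
  interpret h: ring_hom_ring R S h
    using R S h by (intro ring_hom_ringI2) (auto simp: ring_iso_def)
  interpret g: ring_hom_ring S R ?g
    using R S g by (intro ring_hom_ringI2) (auto simp: ring_iso_def)
  have bij: "bij_betw h (carrier R) (carrier S)" "bij_betw ?g (carrier S) (carrier R)"
    using h g by (auto simp: ring_iso_def)
  have himg: "ideal (h ` I) S" if "ideal I R" for I
    using h.image_ideal that bij by (simp add: bij_betw_def)
  have gimg: "ideal (?g ` I) R" if "ideal I S" for I
    using g.image_ideal that bij by (simp add: bij_betw_def)
  have sub: "I \<subseteq> carrier R" if "ideal I R" for I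
    using that by (auto dest: ideal.Icarr)
  have sub': "I \<subseteq> carrier S" if "ideal I S" for I
    using that by (auto dest: ideal.Icarr)
  have "bij_betw ((`) h) {I. ideal I R} {I. ideal I S}"
  proof (rule bij_betw_byWitness[where f' = "(`) ?g"])
    show "\<forall>I\<in>{I. ideal I R}. ?g ` h ` I = I"
      using sub bij(1) by (auto simp: bij_betw_def)
    show "\<forall>I\<in>{I. ideal I S}. h ` ?g ` I = I"
      using sub' bij(1) by (auto simp: bij_betw_def image_inv_into_cancel)
  qed (use himg gimg in auto)
  then show ?thesis
    using himg h.image_ideal_prod by (auto simp: iso_def hom_def ideals_set_def)
qed

theorem theorem2p2:
  fixes R :: "('a, 'm) ring_scheme" and S :: "('b, 'n) ring_scheme"
  assumes "cring R" and "finite (carrier R)"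
    and "cring S" and "finite (carrier S)"
    and "R \<simeq> S"
  shows "\<forall>k\<ge>2. ideal_zero_prob k R = ideal_zero_prob k S"
proof (intro allI impI)
  fix k :: nat
  interpret R: cring R by fact
  interpret S: cring S by fact
  obtain h where h: "h \<in> ring_iso R S"
    using \<open>R \<simeq> S\<close> by (auto simp: is_ring_iso_def)
  interpret h: ring_hom_ring R S h
    using h R.ring_axioms S.ring_axioms by (intro ring_hom_ringI2) (auto simp: ring_iso_def)
  have iso: "(`) h \<in> iso (ideals_set R) (ideals_set S)"
    by (rule image_iso_ideals_set[OF R.ring_axioms S.ring_axioms h])
  have carr: "all_ideals R = carrier (ideals_set R)" "all_ideals S = carrier (ideals_set S)"
    by (auto simp: all_ideals_def ideals_set_def)
  have "card (all_ideals R) = card (all_ideals S)"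
    using iso unfolding carr iso_def by (auto intro: bij_betw_same_card)
  moreover have "card (zero_product_tuples R k) = card (zero_product_tuples S k)"
  proof -
    \<comment> \<open>The unit of the monoid of ideals is the whole ring, so this is surjectivity of
      \<open>h\<close>.\<close>
    have "h ` \<one>\<^bsub>ideals_set R\<^esub> = \<one>\<^bsub>ideals_set S\<^esub>"
      using ring_iso_memE(5)[OF h] by (simp add: ideals_set_def bij_betw_def)
    moreover have "{\<zero>\<^bsub>R\<^esub>} \<in> carrier (ideals_set R)"
      by (simp add: ideals_set_def R.zeroideal)
    \<comment> \<open>Commutativity of the rings makes the ideals commutative monoids. The target
      fibre lies over the image of the zero ideal, which is again zero because \<open>h\<close>
      preserves zero.\<close>
    ultimately show ?thesis
      using card_finprod_eq_iso[OF R.ideals_set_is_comm_monoid S.ideals_set_is_comm_monoid iso,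
          of "{..<k}" "{\<zero>\<^bsub>R\<^esub>}"]
      by (simp add: zero_product_tuples_def carr)
  qed
  ultimately show "ideal_zero_prob k R = ideal_zero_prob k S"
    by (simp add: ideal_zero_prob_def)
qed

end
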